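(* Let $\mu$ be a positive finite Borel measure on $(0,1)$ and let $\beta>-1$. (1) Let $1\le p<\infty$ and let $w(m)=(m+1)_{\beta}$ for $m\in\mathbb{N}_0$. Then $H_{\mu}^{\beta}$ is bounded on $l^p_w$ if and only if $$\mathcal{C}_{\mu}(\beta,p)=\int_{(0,1)}(1-t)^{-(1-\frac1p)(\beta+1)}\,t^{-\frac1p(\beta+1)}\,d\mu(t)<\infty.$$ Moreover, when $H_{\mu}^{\beta}$ is bounded on $l^p_w$, the norm of $H_{\mu}^{\beta}$ is $\mathcal{C}_{\mu}(\beta,p)$. (2) $H_{\mu}^{\beta}$ is bounded on $l^{\infty}$ if and only if $$\mathcal{C}_{\mu}(\beta,\infty)=\int_{(0,1)}(1-t)^{-\beta-1}\,d\mu(t)<\infty.$$ Moreover, when $H_{\mu}^{\beta}$ is bounded on $l^\infty$, the norm of $H_{\mu}^{\beta}$ is $\mathcal{C}_{\mu}(\beta,\infty)$.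
   Context: $\mathbb{N}_0=\{0,1,2,\dots\}$ and $\Gamma$ is the Gamma function. For $m\in\mathbb{N}_0$ and $\beta>-1$, $(m+1)_\beta:=\Gamma(m+\beta+1)/\Gamma(m+1)$. For $\gamma\in\mathbb{R}$ and $m\in\mathbb{N}_0$, $\binom{\gamma}{m}:=\frac{\gamma(\gamma-1)\cdots(\gamma-m+1)}{m!}$, with $\binom{\gamma}{0}=1$. For a weight $w:\mathbb{N}_0\to[0,\infty)$ and $1\le p<\infty$, $l^p_w$ is the space of complex sequences $a=\{a_n\}_{n=0}^\infty$ with $\|a\|_{p,w}=\big(\sum_{n=0}^\infty w(n)|a_n|^p\big)^{1/p}<\infty$; $l^\infty$ is the space of bounded complex sequences with the sup norm. For $\beta>-1$, a positive finite Borel measure $\mu$ on $(0,1)$ and a complex sequence $a=\{a_m\}_{m=0}^\infty$, $$H_{\mu}^{\beta}(a)(n):=\sum_{m=0}^{\infty}\int_{(0,1)}\binom{n+m+\beta}{m}t^m(1-t)^{n}a_m\,d\mu(t),\qquad n\in\mathbb{N}_0.$$ Bounded on $X$ means: for every $a\in X$ the series defining $H_\mu^{\beta}(a)(n)$ converges for every $n$, and there is a constant $C$ with $\|H_\mu^{\beta}(a)\|_X\le C\|a\|_X$ for all $a\in X$; the norm is the least such $C$. *)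

theory Defs
  imports "HOL-Analysis.Analysis"
begin

text \<open>\<open>rising m \<beta>\<close> is $(m+1)_\beta$.\<close>

definition rising :: "nat \<Rightarrow> real \<Rightarrow> real" where
  "rising m \<beta> = Gamma (real m + \<beta> + 1) / Gamma (real m + 1)"

definition lp_space :: "real \<Rightarrow> (nat \<Rightarrow> real) \<Rightarrow> (nat \<Rightarrow> complex) set" where
  "lp_space p w = {a. summable (\<lambda>n. w n * cmod (a n) powr p)}"

definition lp_norm :: "real \<Rightarrow> (nat \<Rightarrow> real) \<Rightarrow> (nat \<Rightarrow> complex) \<Rightarrow> real" where
  "lp_norm p w a = (\<Sum>n. w n * cmod (a n) powr p) powr (1 / p)"

definition linf_space :: "(nat \<Rightarrow> complex) set" where
  "linf_space = {a. bounded (range a)}"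

definition linf_norm :: "(nat \<Rightarrow> complex) \<Rightarrow> real" where
  "linf_norm a = (SUP n. cmod (a n))"

definition hilbert_term ::
    "real measure \<Rightarrow> real \<Rightarrow> (nat \<Rightarrow> complex) \<Rightarrow> nat \<Rightarrow> nat \<Rightarrow> complex" where
  "hilbert_term \<mu> \<beta> a n m =
     (\<integral>t. complex_of_real (((real n + real m + \<beta>) gchoose m) * t ^ m * (1 - t) ^ n) * a m \<partial>\<mu>)"

definition hilbert_op ::
    "real measure \<Rightarrow> real \<Rightarrow> (nat \<Rightarrow> complex) \<Rightarrow> nat \<Rightarrow> complex" where
  "hilbert_op \<mu> \<beta> a n = (\<Sum>m. hilbert_term \<mu> \<beta> a n m)"

text \<open>
  In the next three definitions the normed sequence space is given by its carrier \<open>X\<close> and its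
  norm \<open>N\<close>. As \<open>N\<close> is real-valued and meaningless outside \<open>X\<close>, the inequality
  $\|H a\|_X \le C \|a\|_X < \infty$ has to include \<open>hilbert_op \<mu> \<beta> a \<in> X\<close>. Likewise
  summability is required because \<open>suminf\<close> is total.
\<close>

definition hilbert_bound ::
    "real measure \<Rightarrow> real \<Rightarrow> (nat \<Rightarrow> complex) set \<Rightarrow> ((nat \<Rightarrow> complex) \<Rightarrow> real) \<Rightarrow> real \<Rightarrow> bool" where
  "hilbert_bound \<mu> \<beta> X N C \<longleftrightarrow>
     (\<forall>a\<in>X. (\<forall>n. summable (hilbert_term \<mu> \<beta> a n)) \<and>
            hilbert_op \<mu> \<beta> a \<in> X \<and>
            N (hilbert_op \<mu> \<beta> a) \<le> C * N a)"

definition hilbert_bounded_on ::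
    "real measure \<Rightarrow> real \<Rightarrow> (nat \<Rightarrow> complex) set \<Rightarrow> ((nat \<Rightarrow> complex) \<Rightarrow> real) \<Rightarrow> bool" where
  "hilbert_bounded_on \<mu> \<beta> X N \<longleftrightarrow> (\<exists>C. hilbert_bound \<mu> \<beta> X N C)"

definition hilbert_norm_on ::
    "real measure \<Rightarrow> real \<Rightarrow> (nat \<Rightarrow> complex) set \<Rightarrow> ((nat \<Rightarrow> complex) \<Rightarrow> real) \<Rightarrow> real" where
  "hilbert_norm_on \<mu> \<beta> X N = (LEAST C. hilbert_bound \<mu> \<beta> X N C)"

definition C_fin :: "real measure \<Rightarrow> real \<Rightarrow> real \<Rightarrow> ennreal" where
  "C_fin \<mu> \<beta> p =
     (\<integral>\<^sup>+ t. ennreal ((1 - t) powr (- (1 - 1 / p) * (\<beta> + 1)) * t powr (- (1 / p) * (\<beta> + 1))) \<partial>\<mu>)"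

definition C_inf :: "real measure \<Rightarrow> real \<Rightarrow> ennreal" where
  "C_inf \<mu> \<beta> = (\<integral>\<^sup>+ t. ennreal ((1 - t) powr (- \<beta> - 1)) \<partial>\<mu>)"

end

theory Submission
  imports Defs
begin

text \<open>
  For fixed \<open>t\<close> the kernel \<open>binom(n + m + \<beta>, m) t^m (1 - t)^n\<close> is a negative binomial distribution in \<open>m\<close>
  up to the factor \<open>(1 - t)^(-\<beta>-1)\<close>, and the duality \<open>t \<leftrightarrow> 1 - t\<close>, \<open>n \<leftrightarrow> m\<close> turns row sums into
  column sums weighted by \<open>(n+1)_\<beta>\<close>. The upper bound is a Schur test with the weight
  \<open>h(t) = (t/(1-t))^((\<beta>+1)/p)\<close>, in which Young's inequality is applied before integrating over both \<open>m\<close>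
  and \<open>t\<close>, so that no integral version of Minkowski's inequality is needed.
  For the lower bound, Jensen's inequality for the negative binomial distribution and the convex function
  \<open>x^(-s)\<close> gives a pointwise bound of the image of \<open>a_m = (m+\<beta>+1)^(-s)\<close>. Letting \<open>s\<close> decrease to
  \<open>(\<beta>+1)/p\<close>, where this sequence leaves the space, produces the constant. On bounded sequences the constant
  sequence \<open>1\<close> is extremal.
\<close>

subsection \<open>The kernel for fixed \<open>t\<close>\<close>

definition kern :: "real \<Rightarrow> real \<Rightarrow> nat \<Rightarrow> nat \<Rightarrow> real" where
  "kern \<beta> t n m = ((real n + real m + \<beta>) gchoose m) * t ^ m * (1 - t) ^ n"

text \<open>The rising factorial form makes positivity evident for \<open>\<beta> > -1\<close> and
  reduces index shifts to \<open>pochhammer_rec\<close>.\<close>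

lemma kern_pochhammer:
  "kern \<beta> t n m = pochhammer (real n + \<beta> + 1) m / fact m * t ^ m * (1 - t) ^ n"
  by (simp add: kern_def gbinomial_pochhammer' algebra_simps)

lemma kern_pos:
  assumes "\<beta> > -1" "0 < t" "t < 1"
  shows "kern \<beta> t n m > 0"
  using assms by (auto simp: kern_pochhammer intro!: mult_pos_pos divide_pos_pos pochhammer_pos)

lemma kern_nonneg:
  assumes "\<beta> > -1" "0 < t" "t < 1"
  shows "kern \<beta> t n m \<ge> 0"
  using kern_pos[OF assms] by (rule less_imp_le)

text \<open>Negative binomial series with \<open>r = n + \<beta> + 1\<close>: the sum over
  \<open>m\<close> without the factor \<open>(1 - t) ^ n\<close> is \<open>(1 - t) powr - r\<close>,
  and that factor removes the dependence on \<open>n\<close>.\<close>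

lemma kern_sums:
  assumes "0 < t" "t < 1"
  shows "kern \<beta> t n sums (1 - t) powr (- \<beta> - 1)"
proof -
  define r where "r = real n + \<beta> + 1"
  have "(\<lambda>m. (- r gchoose m) * (- t) ^ m) sums (1 + - t) powr - r"
    using assms by (intro gen_binomial_real) auto
  also have "(\<lambda>m. (- r gchoose m) * (- t) ^ m) = (\<lambda>m. ((real n + real m + \<beta>) gchoose m) * t ^ m)"
  proof (rule ext)
    fix m
    have "(- r gchoose m) * (- t) ^ m = ((- 1) ^ m * (- 1) ^ m) * ((r + real m - 1) gchoose m) * t ^ m"
      unfolding gbinomial_minus power_minus[of t] by (simp only: mult_ac)
    also have "r + real m - 1 = real n + real m + \<beta>"
      by (simp add: r_def)
    finally show "(- r gchoose m) * (- t) ^ m = ((real n + real m + \<beta>) gchoose m) * t ^ m"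
      by (simp flip: power_mult_distrib)
  qed
  finally have "(\<lambda>m. ((real n + real m + \<beta>) gchoose m) * t ^ m * (1 - t) ^ n)
      sums ((1 + - t) powr - r * (1 - t) ^ n)"
    by (rule sums_mult2)
  also have "(1 + - t) powr - r * (1 - t) ^ n = (1 - t) powr (- \<beta> - 1)"
    using assms by (simp add: r_def flip: powr_realpow powr_add)
  finally show ?thesis
    by (simp add: kern_def[abs_def])
qed

text \<open>Multiplying by the index raises \<open>n\<close> by one, because
  \<open>pochhammer r (m + 1) = r * pochhammer (r + 1) m\<close>. First moments thereby become row
  sums.\<close>

lemma kern_Suc:
  assumes "t \<noteq> 1"
  shows "real (Suc m) * kern \<beta> t n (Suc m) = (real n + \<beta> + 1) * t / (1 - t) * kern \<beta> t (Suc n) m"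
proof -
  define u where "u = 1 - t"
  have u: "u \<noteq> 0"
    using assms by (simp add: u_def)
  have e: "real (Suc n) + \<beta> + 1 = real n + \<beta> + 1 + 1"
    by simp
  have cancel: "k * (r * q / (k * f) * (t * x) * y) = r * t / u * (q / f * x * (u * y))"
    if "k \<noteq> 0" for k r q f x y :: real
    using u that by simp
  show ?thesis
    unfolding kern_pochhammer u_def[symmetric] pochhammer_rec fact_Suc power_Suc of_nat_mult e
      of_nat_fact by (rule cancel) simp
qed

text \<open>By \<open>kern_Suc\<close> the first moment is a multiple of the row sum for
  \<open>n + 1\<close>, which has the same value as that for \<open>n\<close>. With the offset
  \<open>\<beta> + 1\<close> the terms in \<open>\<beta> * t\<close> cancel in the
  numerator.\<close>

lemma kern_mean_sums:
  assumes "0 < t" "t < 1"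
  shows "(\<lambda>m. kern \<beta> t n m * (real m + \<beta> + 1)) sums
     ((1 - t) powr (- \<beta> - 1) * ((real n * t + \<beta> + 1) / (1 - t)))"
proof -
  let ?R = "(1 - t) powr (- \<beta> - 1)"
  let ?b = "(real n + \<beta> + 1) * t / (1 - t)"
  have "(\<lambda>m. ?b * kern \<beta> t (Suc n) m) sums (?b * ?R)"
    by (intro sums_mult kern_sums assms)
  then have "(\<lambda>m. real (Suc m) * kern \<beta> t n (Suc m)) sums (?b * ?R)"
    using assms by (simp only: kern_Suc)
  \<comment> \<open>The term at \<open>m = 0\<close> vanishes, so undoing the index shift adds
    nothing to the sum.\<close>
  then have "(\<lambda>m. real m * kern \<beta> t n m) sums (?b * ?R)"
    by (subst (asm) sums_Suc_iff) simp
  moreover have "(\<lambda>m. (\<beta> + 1) * kern \<beta> t n m) sums ((\<beta> + 1) * ?R)"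
    by (intro sums_mult kern_sums assms)
  ultimately have "(\<lambda>m. real m * kern \<beta> t n m + (\<beta> + 1) * kern \<beta> t n m) sums
     (?b * ?R + (\<beta> + 1) * ?R)"
    by (rule sums_add)
  moreover have "?b * ?R + (\<beta> + 1) * ?R = ?R * ((real n * t + \<beta> + 1) / (1 - t))"
    using assms by (simp add: divide_simps) (simp add: algebra_simps)
  ultimately show ?thesis
    by (simp add: algebra_simps)
qed

section \<open>The weights and the duality of the kernel\<close>

lemma rising_pos: "\<beta> > -1 \<Longrightarrow> rising m \<beta> > 0"
  by (auto simp: rising_def intro!: divide_pos_pos Gamma_real_pos)

lemma rising_nonneg: "\<beta> > -1 \<Longrightarrow> rising m \<beta> \<ge> 0"
  using rising_pos by (rule less_imp_le)

text \<open>Both sides equal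
  \<open>Gamma (n + m + \<beta> + 1) / (n! m!) * t ^ m * (1 - t) ^ n\<close>.\<close>

lemma rising_kern_swap:
  assumes "\<beta> > -1"
  shows "rising n \<beta> * kern \<beta> t n m = rising m \<beta> * kern \<beta> (1 - t) m n"
proof -
  have P: "pochhammer (real n + \<beta> + 1) m = Gamma (real n + real m + \<beta> + 1) / Gamma (real n + \<beta> + 1)" for n m
  proof -
    have "real n + \<beta> + 1 \<notin> \<int>\<^sub>\<le>\<^sub>0"
      using assms by (auto elim!: nonpos_Ints_cases)
    from pochhammer_Gamma[OF this, of m] show ?thesis
      by (simp add: add_ac)
  qed
  have G: "Gamma (real n + \<beta> + 1) > 0" for n
    using assms by (intro Gamma_real_pos) auto
  have F: "Gamma (real k + 1) = fact k" for k
    using Gamma_fact[of k, where 'a = real] by (simp add: add_ac)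
  show ?thesis
    using G[of n] G[of m] unfolding kern_pochhammer P rising_def F by (simp add: add_ac mult_ac)
qed

lemma rising_kern_sums:
  assumes "\<beta> > -1" "0 < t" "t < 1"
  shows "(\<lambda>n. rising n \<beta> * kern \<beta> t n m) sums (rising m \<beta> * t powr (- \<beta> - 1))"
proof -
  have "kern \<beta> (1 - t) m sums (1 - (1 - t)) powr (- \<beta> - 1)"
    using assms by (intro kern_sums) auto
  then have "(\<lambda>n. rising m \<beta> * kern \<beta> (1 - t) m n) sums (rising m \<beta> * t powr (- \<beta> - 1))"
    by (intro sums_mult) simp
  then show ?thesis
    by (subst rising_kern_swap[OF assms(1)])
qed

text \<open>The tangent at \<open>y = 1\<close> lies below the convex function. This follows from
  \<open>ln y \<le> y - 1\<close> and \<open>1 + x \<le> exp x\<close>.\<close>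

lemma powr_neg_tangent:
  fixes s y :: real
  assumes "0 \<le> s" "0 < y"
  shows "1 + s - s * y \<le> y powr - s"
proof -
  have "s * ln y \<le> s * (y - 1)"
    using assms by (intro mult_left_mono ln_le_minus_one) auto
  moreover have "1 + - s * ln y \<le> exp (- s * ln y)"
    by (rule exp_ge_add_one_self)
  ultimately show ?thesis
    using assms by (simp add: powr_def algebra_simps)
qed

text \<open>Jensen's inequality: by \<open>kern_mean_sums\<close> the variable \<open>m + \<beta> + 1\<close> has mean \<open>X\<close>, and the tangent of \<open>y powr - s\<close> at
  \<open>y = 1\<close> is applied to \<open>y = (m + \<beta> + 1) / X\<close>.\<close>

lemma kern_powr_lower:
  assumes "\<beta> > -1" "0 < t" "t < 1" "0 \<le> s"
  shows "ennreal ((1 - t) powr (s - \<beta> - 1) * (real n * t + \<beta> + 1) powr - s)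
     \<le> (\<Sum>m. ennreal (kern \<beta> t n m * (real m + \<beta> + 1) powr - s))"
proof -
  define X where "X = (real n * t + \<beta> + 1) / (1 - t)"
  let ?R = "(1 - t) powr (- \<beta> - 1)"
  let ?f = "\<lambda>m. kern \<beta> t n m * (real m + \<beta> + 1) powr - s"
  have num: "real n * t + \<beta> + 1 > 0"
    using assms mult_nonneg_nonneg[of "real n" t] by linarith
  then have X: "X > 0"
    using assms by (simp add: X_def)
  have nn: "0 \<le> ?f m" for m
    using kern_nonneg[of \<beta> t n m] assms by simp
  have R: "(1 - t) powr (s - \<beta> - 1) * (real n * t + \<beta> + 1) powr - s = ?R * X powr - s"
    using assms num
    by (simp add: X_def powr_divide powr_minus_divide[of _ s] powr_diff field_simps)
       (simp add: powr_minus powr_add field_simps)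
  show ?thesis
  \<comment> \<open>An infinite sum satisfies the bound trivially; a finite one gives the real
    summability needed to add up the tangent inequalities.\<close>
  proof (cases "(\<Sum>m. ennreal (?f m)) = top")
    case False
    have sf: "summable ?f"
      using nn False by (rule summable_suminf_not_top)
    \<comment> \<open>Total mass and mean sum the tangent line exactly. As the mean is
      \<open>X\<close>, the two contributions of \<open>s\<close> cancel and only \<open>?R\<close>
      remains.\<close>
    have 1: "(\<lambda>m. kern \<beta> t n m * (1 + s) - (kern \<beta> t n m * (real m + \<beta> + 1)) * (s / X)) sums
        (?R * (1 + s) - (?R * X) * (s / X))"
      unfolding X_def using assms by (intro sums_diff sums_mult2 kern_sums kern_mean_sums)
    have "?R * X powr - s = (?R * (1 + s) - (?R * X) * (s / X)) * X powr - s"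
      using X by (simp add: field_simps)
    also have "\<dots> \<le> (\<Sum>m. ?f m)"
    proof (rule sums_le[OF _ sums_mult2[OF 1] summable_sums[OF sf]])
      fix m
      let ?y = "(real m + \<beta> + 1) / X"
      have "kern \<beta> t n m * ((1 + s - s * ?y) * X powr - s)
          \<le> kern \<beta> t n m * (?y powr - s * X powr - s)"
        using assms X kern_nonneg[of \<beta> t n m]
        by (intro mult_right_mono mult_left_mono powr_neg_tangent) auto
      also have "?y powr - s * X powr - s = (real m + \<beta> + 1) powr - s"
        using assms X by (simp add: powr_divide)
      finally show "(kern \<beta> t n m * (1 + s) - (kern \<beta> t n m * (real m + \<beta> + 1)) * (s / X)) * X powr - s
          \<le> kern \<beta> t n m * (real m + \<beta> + 1) powr - s"
        by (simp add: algebra_simps divide_inverse)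
    qed
    finally show ?thesis
      unfolding R using nn sf by (simp add: suminf_ennreal2 ennreal_leI)
  qed simp
qed

text \<open>Young's inequality \<open>p * y \<le> y powr p + (p - 1)\<close> at
  \<open>y = h * x / \<theta>\<close>, rescaled by \<open>\<theta> / h\<close>. The parameter
  \<open>\<theta>\<close> stays free so that it can be optimised after integration.\<close>

lemma Young_weighted:
  fixes x \<theta> h p :: real
  assumes "1 \<le> p" "0 \<le> x" "0 < \<theta>" "0 < h"
  shows "p * x \<le> \<theta> powr (1 - p) * (h powr (p - 1) * x powr p) + (p - 1) * \<theta> * inverse h"
proof (cases "x = 0")
  case False
  define y where "y = h * x / \<theta>"
  have y: "y > 0" using False assms by (simp add: y_def)
  have "(y powr p) powr (1 / p) * 1 powr (1 - 1 / p) \<le> (1 / p) * y powr p + (1 - 1 / p) * 1"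
    using assms y by (intro Youngs_inequality_0) auto
  then have "p * y \<le> y powr p + (p - 1)"
    using assms y mult_left_mono[of "y" "(1 / p) * y powr p + (1 - 1 / p)" p]
    by (simp add: powr_powr distrib_left right_diff_distrib)
  then have "p * y * (\<theta> / h) \<le> (y powr p + (p - 1)) * (\<theta> / h)"
    using assms by (intro mult_right_mono) auto
  moreover have "p * y * (\<theta> / h) = p * x"
    using assms by (simp add: y_def)
  moreover have "y powr p * (\<theta> / h) = \<theta> powr (1 - p) * (h powr (p - 1) * x powr p)"
    using assms False by (simp add: y_def powr_mult powr_divide powr_diff field_simps)
  moreover have "(y powr p + (p - 1)) * (\<theta> / h) = y powr p * (\<theta> / h) + (p - 1) * \<theta> * inverse h"
    by (simp add: distrib_right divide_inverse)
  ultimately show ?thesis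
    by linarith
qed (use assms in auto)

text \<open>Euler's limit formula for the Gamma function applies to \<open>rising n \<beta> * (n + \<beta> + 1)\<close>, a multiple of \<open>pochhammer (\<beta> + 1) (n + 1) / n!\<close>.\<close>

lemma rising_asymp:
  assumes "\<beta> > -1"
  shows "(\<lambda>n. rising n \<beta> * (real n + \<beta> + 1) / real n powr (\<beta> + 1)) \<longlonglongrightarrow> 1"
proof -
  have nz: "\<beta> + 1 \<notin> \<int>\<^sub>\<le>\<^sub>0"
    using assms by (auto elim!: nonpos_Ints_cases)
  have G: "Gamma (\<beta> + 1) > 0"
    using assms by (intro Gamma_real_pos) auto
  have "(\<lambda>n. Gamma (\<beta> + 1) * rGamma_series (\<beta> + 1) n) \<longlonglongrightarrow> Gamma (\<beta> + 1) * rGamma (\<beta> + 1)"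
    by (intro tendsto_intros)
  also have "Gamma (\<beta> + 1) * rGamma (\<beta> + 1) = 1"
    using G by (simp add: rGamma_inverse_Gamma)
  finally show ?thesis
  proof (rule Lim_transform_eventually)
    show "\<forall>\<^sub>F n in sequentially. Gamma (\<beta> + 1) * rGamma_series (\<beta> + 1) n =
        rising n \<beta> * (real n + \<beta> + 1) / real n powr (\<beta> + 1)"
      using eventually_gt_at_top[of "0::nat"]
    proof eventually_elim
      case (elim n)
      have F: "Gamma (real n + 1) = fact n"
        using Gamma_fact[of n, where 'a = real] by (simp add: add_ac)
      have "real n + \<beta> + 1 \<notin> \<int>\<^sub>\<le>\<^sub>0"
        using assms by (auto elim!: nonpos_Ints_cases)
      then have "Gamma (real n + \<beta> + 1 + 1) = (real n + \<beta> + 1) * Gamma (real n + \<beta> + 1)"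
        by (intro Gamma_plus1)
      then show ?case
        using elim G F pochhammer_Gamma[OF nz, of "n + 1"]
        by (simp add: rGamma_series_def rising_def powr_def add_ac field_simps)
    qed
  qed
qed

text \<open>The terms are asymptotic to \<open>n powr (\<beta> - s)\<close>, so this is the
  criterion for power series of the form \<open>n powr q\<close>. The divergence at
  \<open>s = \<beta> + 1\<close> is what the lower bound rests on.\<close>

lemma summable_rising_powr_iff:
  assumes "\<beta> > -1"
  shows "summable (\<lambda>n. rising n \<beta> * (real n + \<beta> + 1) powr - s) \<longleftrightarrow> s > \<beta> + 1"
proof -
  \<comment> \<open>The second factor tends to one and trades powers of
    \<open>n + \<beta> + 1\<close> for powers of \<open>n\<close>.\<close>
  have "(\<lambda>n. rising n \<beta> * (real n + \<beta> + 1) / real n powr (\<beta> + 1) *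
            ((real n + \<beta> + 1) / real n) powr (- s - 1)) \<longlonglongrightarrow> 1 * 1 powr (- s - 1)"
  proof (intro tendsto_mult rising_asymp assms tendsto_powr tendsto_const)
    have "(\<lambda>n. 1 + (\<beta> + 1) * inverse (real n)) \<longlonglongrightarrow> 1 + (\<beta> + 1) * 0"
      by (intro tendsto_intros lim_inverse_n)
    then show "(\<lambda>n. (real n + \<beta> + 1) / real n) \<longlonglongrightarrow> 1"
      by (simp, elim Lim_transform_eventually)
        (auto intro!: eventually_mono[OF eventually_gt_at_top[of "0::nat"]] simp: field_simps)
  qed auto
  moreover have "\<forall>\<^sub>F n in sequentially. rising n \<beta> * (real n + \<beta> + 1) / real n powr (\<beta> + 1) *
            ((real n + \<beta> + 1) / real n) powr (- s - 1) =
       rising n \<beta> * (real n + \<beta> + 1) powr - s / real n powr (\<beta> - s)"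
    using eventually_gt_at_top[of "0::nat"]
  proof eventually_elim
    case (elim n)
    then have "real n + \<beta> + 1 > 0" using assms by simp
    then obtain M where M: "M = real n + \<beta> + 1" "M > 0" by simp
    show ?case
      using elim M(2) unfolding M(1)[symmetric]
      by (simp add: powr_divide powr_diff powr_minus powr_add field_simps)
  qed
  ultimately have lim: "(\<lambda>n. rising n \<beta> * (real n + \<beta> + 1) powr - s / real n powr (\<beta> - s)) \<longlonglongrightarrow> 1"
    using Lim_transform_eventually by fastforce
  have ev: "\<forall>\<^sub>F n in sequentially. 1 / 2 * real n powr (\<beta> - s) \<le> rising n \<beta> * (real n + \<beta> + 1) powr - s
      \<and> rising n \<beta> * (real n + \<beta> + 1) powr - s \<le> 2 * real n powr (\<beta> - s)"
    using order_tendstoD(1)[OF lim, of "1/2", simplified] order_tendstoD(2)[OF lim, of 2, simplified]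
      eventually_gt_at_top[of "0::nat"]
    by eventually_elim (auto simp: field_simps)
  have pos: "0 \<le> rising n \<beta> * (real n + \<beta> + 1) powr - s" for n
    using rising_nonneg[OF assms] by simp
  have "summable (\<lambda>n. rising n \<beta> * (real n + \<beta> + 1) powr - s) \<longleftrightarrow>
      summable (\<lambda>n. real n powr (\<beta> - s))"
  proof
    assume "summable (\<lambda>n. rising n \<beta> * (real n + \<beta> + 1) powr - s)"
    then have "summable (\<lambda>n. 2 * (rising n \<beta> * (real n + \<beta> + 1) powr - s))"
      by (rule summable_mult)
    then show "summable (\<lambda>n. real n powr (\<beta> - s))"
      by (rule summable_comparison_test_ev[rotated]) (use ev in \<open>auto elim!: eventually_mono\<close>)
  next
    assume "summable (\<lambda>n. real n powr (\<beta> - s))"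
    then have "summable (\<lambda>n. 2 * real n powr (\<beta> - s))"
      by (rule summable_mult)
    then show "summable (\<lambda>n. rising n \<beta> * (real n + \<beta> + 1) powr - s)"
      by (rule summable_comparison_test_ev[rotated])
        (use ev pos in \<open>auto elim!: eventually_mono\<close>)
  qed
  then show ?thesis
    by (simp add: summable_real_powr_iff) linarith
qed

subsection \<open>Bounded sequences\<close>

text \<open>Tonelli's theorem for counting measure.\<close>

lemma ennreal_suminf_swap:
  fixes f :: "nat \<Rightarrow> nat \<Rightarrow> ennreal"
  shows "(\<Sum>n. \<Sum>m. f n m) = (\<Sum>m. \<Sum>n. f n m)"
proof -
  have "(\<Sum>n. \<Sum>m. f n m) = (\<Sum>n. \<integral>\<^sup>+ m. f n m \<partial>count_space UNIV)"
    by (simp add: nn_integral_count_space_nat)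
  also have "\<dots> = (\<integral>\<^sup>+ m. (\<Sum>n. f n m) \<partial>count_space UNIV)"
    by (rule nn_integral_suminf[symmetric]) simp
  also have "\<dots> = (\<Sum>m. \<Sum>n. f n m)"
    by (rule nn_integral_count_space_nat)
  finally show ?thesis .
qed

section \<open>The operator as a matrix with nonnegative entries\<close>

locale hilbert_measure = finite_measure \<mu> for \<mu> :: "real measure" +
  fixes \<beta> :: real
  assumes sets_mu: "sets \<mu> = sets (restrict_space borel {0<..<1})"
    and beta: "\<beta> > -1"
begin

abbreviation "w \<equiv> (\<lambda>n. rising n \<beta>)"

lemma space_mu: "space \<mu> = {0<..<1}"
  using sets_eq_imp_space_eq[OF sets_mu] by (simp add: space_restrict_space)

lemma ident_measurable [measurable]: "(\<lambda>t. t) \<in> borel_measurable \<mu>"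
  by (simp add: measurable_cong_sets[OF sets_mu refl] measurable_restrict_space1)

lemma kern_measurable [measurable]: "(\<lambda>t. kern \<beta> t n m) \<in> borel_measurable \<mu>"
  unfolding kern_def by measurable

definition hkern :: "nat \<Rightarrow> nat \<Rightarrow> real" where
  "hkern n m = (\<integral>t. kern \<beta> t n m \<partial>\<mu>)"

text \<open>On the unit interval \<open>t ^ m * (1 - t) ^ n\<close> is at most one and
  \<open>\<mu>\<close> is finite, so every matrix entry is a genuine integral even when
  \<open>C_fin\<close> or \<open>C_inf\<close> is infinite.\<close>

lemma integrable_kern: "integrable \<mu> (\<lambda>t. kern \<beta> t n m)"
proof (rule integrable_const_bound[where B = "\<bar>(real n + real m + \<beta>) gchoose m\<bar>"])
  show "AE t in \<mu>. norm (kern \<beta> t n m) \<le> \<bar>(real n + real m + \<beta>) gchoose m\<bar>"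
  proof (rule AE_I2)
    fix t assume "t \<in> space \<mu>"
    then have t: "0 < t" "t < 1" by (auto simp: space_mu)
    then have "t ^ m * (1 - t) ^ n \<le> 1 * 1"
      by (intro mult_mono power_le_one) auto
    then have "\<bar>(real n + real m + \<beta>) gchoose m\<bar> * (t ^ m * (1 - t) ^ n)
        \<le> \<bar>(real n + real m + \<beta>) gchoose m\<bar> * 1"
      by (intro mult_left_mono) auto
    then show "norm (kern \<beta> t n m) \<le> \<bar>(real n + real m + \<beta>) gchoose m\<bar>"
      using t by (simp add: kern_def abs_mult mult.assoc)
  qed
qed measurable

lemma hkern_nonneg: "0 \<le> hkern n m"
  unfolding hkern_def using beta
  by (intro integral_nonneg_AE AE_I2) (auto simp: space_mu intro!: kern_nonneg)

lemma ennreal_hkern: "ennreal (hkern n m) = (\<integral>\<^sup>+ t. ennreal (kern \<beta> t n m) \<partial>\<mu>)"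
  unfolding hkern_def using beta
  by (intro nn_integral_eq_integral[symmetric] integrable_kern AE_I2)
    (auto simp: space_mu intro!: kern_nonneg)

lemma hilbert_term_hkern: "hilbert_term \<mu> \<beta> a n m = of_real (hkern n m) * a m"
  unfolding hilbert_term_def hkern_def kern_def integral_mult_left_zero integral_complex_of_real ..

lemma norm_hilbert_term: "cmod (hilbert_term \<mu> \<beta> a n m) = hkern n m * cmod (a m)"
  using hkern_nonneg by (simp add: hilbert_term_hkern norm_mult)

text \<open>Tonelli's theorem: the estimates can be carried out for fixed \<open>t\<close> under the
  integral, with no convergence assumed beforehand.\<close>

lemma suminf_hkern:
  assumes "\<And>m. 0 \<le> b m"
  shows "(\<Sum>m. ennreal (hkern n m * b m)) = (\<integral>\<^sup>+ t. (\<Sum>m. ennreal (kern \<beta> t n m * b m)) \<partial>\<mu>)"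
proof -
  have "(\<Sum>m. ennreal (hkern n m * b m)) = (\<Sum>m. \<integral>\<^sup>+ t. ennreal (kern \<beta> t n m * b m) \<partial>\<mu>)"
    using assms by (simp add: ennreal_mult'' ennreal_hkern nn_integral_multc)
  also have "\<dots> = (\<integral>\<^sup>+ t. (\<Sum>m. ennreal (kern \<beta> t n m * b m)) \<partial>\<mu>)"
    by (intro nn_integral_suminf[symmetric]) measurable
  finally show ?thesis .
qed

text \<open>Absolute convergence carries an estimate in \<open>ennreal\<close> back to the complex
  series.\<close>

lemma hilbert_op_bound:
  assumes "(\<Sum>m. ennreal (hkern n m * cmod (a m))) \<le> ennreal B" "0 \<le> B"
  shows "summable (hilbert_term \<mu> \<beta> a n)" "cmod (hilbert_op \<mu> \<beta> a n) \<le> B"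
proof -
  have nn: "0 \<le> hkern n m * cmod (a m)" for m
    by (simp add: hkern_nonneg)
  have s: "summable (\<lambda>m. hkern n m * cmod (a m))"
    using assms nn by (intro summable_suminf_not_top) (auto simp: top_unique)
  then have s': "summable (\<lambda>m. cmod (hilbert_term \<mu> \<beta> a n m))"
    by (simp add: norm_hilbert_term)
  then show "summable (hilbert_term \<mu> \<beta> a n)"
    by (rule summable_norm_cancel)
  have "cmod (hilbert_op \<mu> \<beta> a n) \<le> (\<Sum>m. hkern n m * cmod (a m))"
    unfolding hilbert_op_def using summable_norm[OF s'] by (simp add: norm_hilbert_term)
  also have "\<dots> \<le> B"
    using assms nn s by (simp add: suminf_ennreal2)
  finally show "cmod (hilbert_op \<mu> \<beta> a n) \<le> B" .
qed

text \<open>Nonnegative terms do not cancel, so lower estimates of the kernel sums become lower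
  estimates of the operator.\<close>

lemma hilbert_op_nonneg_real:
  assumes "\<And>m. 0 \<le> b m" "summable (hilbert_term \<mu> \<beta> (\<lambda>m. of_real (b m)) n)"
  shows "ennreal (cmod (hilbert_op \<mu> \<beta> (\<lambda>m. of_real (b m)) n)) =
     (\<integral>\<^sup>+ t. (\<Sum>m. ennreal (kern \<beta> t n m * b m)) \<partial>\<mu>)"
proof -
  have eq: "hilbert_term \<mu> \<beta> (\<lambda>m. of_real (b m)) n = (\<lambda>m. of_real (hkern n m * b m))"
    by (auto simp: hilbert_term_hkern)
  have s: "summable (\<lambda>m. hkern n m * b m)"
    using assms(2) unfolding eq summable_complex_of_real .
  have nn: "0 \<le> hkern n m * b m" for m
    by (simp add: assms hkern_nonneg)
  have "cmod (hilbert_op \<mu> \<beta> (\<lambda>m. of_real (b m)) n) = (\<Sum>m. hkern n m * b m)"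
    unfolding hilbert_op_def eq suminf_of_real[OF s, symmetric] norm_of_real
    using suminf_nonneg[OF s nn] by (rule abs_of_nonneg)
  then show ?thesis
    using suminf_ennreal2[OF nn s] suminf_hkern[of b n] assms by simp
qed

text \<open>By \<open>kern_sums\<close> every row of the matrix has the sum \<open>C_inf\<close>,
  whatever \<open>n\<close> is.\<close>

lemma hilbert_bound_linf:
  assumes "C_inf \<mu> \<beta> < \<infinity>"
  shows "hilbert_bound \<mu> \<beta> linf_space linf_norm (enn2real (C_inf \<mu> \<beta>))"
  unfolding hilbert_bound_def
proof (intro ballI)
  fix a assume "a \<in> linf_space"
  then have "bounded (range a)" by (simp add: linf_space_def)
  then have bdd: "bdd_above (range (\<lambda>n. cmod (a n)))"
    by (auto simp: bounded_iff bdd_above_def)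
  define A where "A = linf_norm a"
  have A: "cmod (a n) \<le> A" for n
    unfolding A_def linf_norm_def by (rule cSUP_upper[OF _ bdd]) simp
  then have A0: "0 \<le> A" using norm_ge_zero order_trans by blast
  let ?C = "enn2real (C_inf \<mu> \<beta>)"
  have C: "ennreal ?C = C_inf \<mu> \<beta>" using assms by simp
  have "(\<Sum>m. ennreal (hkern n m * cmod (a m))) \<le> ennreal (?C * A)" for n
  proof -
    have "(\<Sum>m. ennreal (hkern n m * cmod (a m))) \<le> (\<Sum>m. ennreal (hkern n m * A))"
      using A hkern_nonneg by (intro suminf_le ennreal_leI mult_left_mono) auto
    also have "\<dots> = (\<integral>\<^sup>+ t. (\<Sum>m. ennreal (kern \<beta> t n m * A)) \<partial>\<mu>)"
      using A0 by (intro suminf_hkern)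
    also have "\<dots> = (\<integral>\<^sup>+ t. ennreal ((1 - t) powr (- \<beta> - 1)) * ennreal A \<partial>\<mu>)"
    proof (intro nn_integral_cong)
      fix t assume "t \<in> space \<mu>"
      then have t: "0 < t" "t < 1" by (auto simp: space_mu)
      have "(\<Sum>m. ennreal (kern \<beta> t n m * A)) = ennreal ((1 - t) powr (- \<beta> - 1) * A)"
        using kern_nonneg[OF beta t] A0 by (intro suminf_ennreal_eq sums_mult2 kern_sums t) auto
      then show "(\<Sum>m. ennreal (kern \<beta> t n m * A)) = ennreal ((1 - t) powr (- \<beta> - 1)) * ennreal A"
        using A0 by (simp add: ennreal_mult)
    qed
    also have "\<dots> = C_inf \<mu> \<beta> * ennreal A"
      unfolding C_inf_def by (intro nn_integral_multc) measurable
    also have "\<dots> = ennreal (?C * A)"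
      using A0 by (simp add: ennreal_mult C)
    finally show ?thesis .
  qed
  note * = hilbert_op_bound[OF this mult_nonneg_nonneg[OF enn2real_nonneg A0]]
  have "hilbert_op \<mu> \<beta> a \<in> linf_space"
    unfolding linf_space_def bounded_iff using *(2) by blast
  moreover have "linf_norm (hilbert_op \<mu> \<beta> a) \<le> ?C * linf_norm a"
    unfolding A_def[symmetric] linf_norm_def[of "hilbert_op \<mu> \<beta> a"]
    by (rule cSUP_least) (simp_all add: *(2))
  ultimately show "(\<forall>n. summable (hilbert_term \<mu> \<beta> a n)) \<and> hilbert_op \<mu> \<beta> a \<in> linf_space \<and>
     linf_norm (hilbert_op \<mu> \<beta> a) \<le> ?C * linf_norm a"
    using *(1) by simp
qed

text \<open>The constant sequence one has norm one, and the value of its image at index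
  \<open>0\<close> is \<open>C_inf\<close> itself.\<close>

lemma hilbert_bound_linfD:
  assumes "hilbert_bound \<mu> \<beta> linf_space linf_norm D"
  shows "0 \<le> D" "C_inf \<mu> \<beta> \<le> ennreal D"
proof -
  let ?b = "\<lambda>m::nat. complex_of_real 1"
  have "?b \<in> linf_space" and N: "linf_norm ?b = 1"
    by (auto simp: linf_space_def linf_norm_def)
  from assms this(1) have *: "(\<forall>n. summable (hilbert_term \<mu> \<beta> ?b n)) \<and> hilbert_op \<mu> \<beta> ?b \<in> linf_space \<and>
      linf_norm (hilbert_op \<mu> \<beta> ?b) \<le> D * linf_norm ?b"
    unfolding hilbert_bound_def by (rule bspec)
  then have s: "summable (hilbert_term \<mu> \<beta> ?b n)" for n
    by simp
  from * have mem: "hilbert_op \<mu> \<beta> ?b \<in> linf_space"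
    and le: "linf_norm (hilbert_op \<mu> \<beta> ?b) \<le> D"
    unfolding N by simp_all
  have "C_inf \<mu> \<beta> = (\<integral>\<^sup>+ t. (\<Sum>m. ennreal (kern \<beta> t 0 m * 1)) \<partial>\<mu>)"
    unfolding C_inf_def
  proof (intro nn_integral_cong)
    fix t assume "t \<in> space \<mu>"
    then have t: "0 < t" "t < 1" by (auto simp: space_mu)
    show "ennreal ((1 - t) powr (- \<beta> - 1)) = (\<Sum>m. ennreal (kern \<beta> t 0 m * 1))"
      using kern_nonneg[OF beta t] kern_sums[OF t] by (simp add: suminf_ennreal_eq[symmetric])
  qed
  also have "\<dots> = ennreal (cmod (hilbert_op \<mu> \<beta> ?b 0))"
    using s by (intro hilbert_op_nonneg_real[symmetric]) auto
  finally have C: "C_inf \<mu> \<beta> = ennreal (cmod (hilbert_op \<mu> \<beta> ?b 0))" .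
  have "bdd_above (range (\<lambda>n. cmod (hilbert_op \<mu> \<beta> ?b n)))"
    using mem by (auto simp: linf_space_def bounded_iff bdd_above_def)
  then have "cmod (hilbert_op \<mu> \<beta> ?b 0) \<le> linf_norm (hilbert_op \<mu> \<beta> ?b)"
    unfolding linf_norm_def by (intro cSUP_upper) auto
  also note le
  finally have "cmod (hilbert_op \<mu> \<beta> ?b 0) \<le> D" .
  then show "0 \<le> D" "C_inf \<mu> \<beta> \<le> ennreal D"
    using order_trans[OF norm_ge_zero] by (auto simp: C intro: ennreal_leI)
qed

end

text \<open>Matching upper and lower bounds give both the criterion and the norm. Nonnegativity of
  \<open>D\<close> is a separate assumption because \<open>ennreal\<close> sends negative reals to
  zero, so \<open>C \<le> ennreal D\<close> alone does not bound \<open>D\<close> from below when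
  \<open>C = 0\<close>.\<close>

lemma hilbert_norm_eqI:
  assumes fin: "C < \<infinity> \<Longrightarrow> hilbert_bound \<mu> \<beta> X N (enn2real C)"
    and nonneg: "\<And>D. hilbert_bound \<mu> \<beta> X N D \<Longrightarrow> 0 \<le> D"
    and lower: "\<And>D. hilbert_bound \<mu> \<beta> X N D \<Longrightarrow> C \<le> ennreal D"
  shows "hilbert_bounded_on \<mu> \<beta> X N \<longleftrightarrow> C < \<infinity>"
    and "hilbert_bounded_on \<mu> \<beta> X N \<longrightarrow> hilbert_norm_on \<mu> \<beta> X N = enn2real C"
proof -
  show iff: "hilbert_bounded_on \<mu> \<beta> X N \<longleftrightarrow> C < \<infinity>"
  proof
    assume "hilbert_bounded_on \<mu> \<beta> X N"
    then obtain D where "hilbert_bound \<mu> \<beta> X N D"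
      unfolding hilbert_bounded_on_def by (rule exE)
    then have "C \<le> ennreal D"
      by (rule lower)
    then show "C < \<infinity>"
      by (rule order_le_less_trans) simp
  next
    assume "C < \<infinity>"
    then show "hilbert_bounded_on \<mu> \<beta> X N"
      unfolding hilbert_bounded_on_def by (intro exI[of _ "enn2real C"] fin)
  qed
  have "(LEAST D. hilbert_bound \<mu> \<beta> X N D) = enn2real C" if "C < \<infinity>"
    using fin[OF that] nonneg lower by (intro Least_equality enn2real_leI)
  then show "hilbert_bounded_on \<mu> \<beta> X N \<longrightarrow> hilbert_norm_on \<mu> \<beta> X N = enn2real C"
    unfolding iff hilbert_norm_on_def by (rule impI)
qed

subsection \<open>The upper bound on weighted sequence spaces\<close>

context hilbert_measure
begin

text \<open>The positive slack \<open>0 < D\<close> covers the zero measure, for which the optimal \<open>\<theta>\<close> below is undefined.\<close>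

lemma hilbert_bound_lp_weak:
  assumes p: "1 \<le> p" and D: "0 < D" "C_fin \<mu> \<beta> p \<le> ennreal D"
  shows "hilbert_bound \<mu> \<beta> (lp_space p w) (lp_norm p w) D"
  unfolding hilbert_bound_def
proof (intro ballI)
  fix a assume "a \<in> lp_space p w"
  then have suma: "summable (\<lambda>n. w n * cmod (a n) powr p)"
    by (simp add: lp_space_def)
  let ?C = "C_fin \<mu> \<beta> p"
  define A where "A = (\<Sum>n. w n * cmod (a n) powr p)"
  have w: "0 < w n" "0 \<le> w n" for n
    using rising_pos[OF beta] rising_nonneg[OF beta] by auto
  have A0: "0 \<le> A"
    unfolding A_def using suma w by (intro suminf_nonneg) auto
  \<comment> \<open>The exponent of the Schur weight is chosen so that the row sum times
    \<open>inverse (h t)\<close> and the column factor times \<open>h t powr (p - 1)\<close> are the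
    same function \<open>c t\<close>.\<close>
  define h where "h t = (t / (1 - t)) powr ((\<beta> + 1) / p)" for t :: real
  define c where "c t = (1 - t) powr (- (1 - 1 / p) * (\<beta> + 1)) * t powr (- (1 / p) * (\<beta> + 1))" for t :: real
  have C_eq: "?C = (\<integral>\<^sup>+ t. ennreal (c t) \<partial>\<mu>)"
    by (simp add: C_fin_def c_def)
  have [measurable]: "h \<in> borel_measurable \<mu>" "c \<in> borel_measurable \<mu>"
    unfolding h_def[abs_def] c_def[abs_def] by measurable
  have h0: "0 < h t" if "0 < t" "t < 1" for t
    using that by (simp add: h_def)
  have c0: "0 \<le> c t" for t
    by (simp add: c_def)
  have row: "(1 - t) powr (- \<beta> - 1) * inverse (h t) = c t"
    and col: "t powr (- \<beta> - 1) * h t powr (p - 1) = c t" if t: "0 < t" "t < 1" for t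
  proof -
    have e1: "- \<beta> - 1 + (\<beta> + 1) / p = - (1 - 1 / p) * (\<beta> + 1)"
      and e2: "- ((\<beta> + 1) / p) = - (1 / p) * (\<beta> + 1)"
      and e3: "- \<beta> - 1 + (\<beta> + 1) / p * (p - 1) = - (1 / p) * (\<beta> + 1)"
      and e4: "- ((\<beta> + 1) / p * (p - 1)) = - (1 - 1 / p) * (\<beta> + 1)"
      using p by (simp_all add: field_simps)
    have "inverse (h t) = t powr - ((\<beta> + 1) / p) * (1 - t) powr ((\<beta> + 1) / p)"
      using t by (simp add: h_def powr_divide powr_minus field_simps)
    then show "(1 - t) powr (- \<beta> - 1) * inverse (h t) = c t"
      unfolding c_def e1[symmetric] e2[symmetric] using t by (simp add: powr_add)
    have "h t powr (p - 1) = t powr ((\<beta> + 1) / p * (p - 1)) * (1 - t) powr - ((\<beta> + 1) / p * (p - 1))"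
      using t by (simp add: h_def powr_powr powr_divide) (simp add: powr_minus divide_inverse)
    then show "t powr (- \<beta> - 1) * h t powr (p - 1) = c t"
      unfolding c_def e3[symmetric] e4[symmetric] using t by (simp add: powr_add)
  qed
  define I where "I n = (\<Sum>m. ennreal (hkern n m * cmod (a m)))" for n
  define J where "J n = (\<integral>\<^sup>+ t. (\<Sum>m. ennreal (kern \<beta> t n m * (h t powr (p - 1) * cmod (a m) powr p))) \<partial>\<mu>)" for n

  \<comment> \<open>Young's inequality is used termwise for fixed \<open>t\<close>. In its second
    term the row sum and \<open>inverse (h t)\<close> combine to \<open>c t\<close>, which
    integrates to the constant.\<close>
  have young: "ennreal p * I n \<le> ennreal (\<theta> powr (1 - p)) * J n + ennreal ((p - 1) * \<theta>) * ?C"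
    if \<theta>: "0 < \<theta>" for n \<theta>
  proof -
    have "ennreal p * I n = (\<integral>\<^sup>+ t. ennreal p * (\<Sum>m. ennreal (kern \<beta> t n m * cmod (a m))) \<partial>\<mu>)"
      unfolding I_def by (simp add: suminf_hkern nn_integral_cmult)
    also have "\<dots> \<le> (\<integral>\<^sup>+ t. ennreal (\<theta> powr (1 - p)) *
          (\<Sum>m. ennreal (kern \<beta> t n m * (h t powr (p - 1) * cmod (a m) powr p)))
        + ennreal ((p - 1) * \<theta>) * ennreal (c t) \<partial>\<mu>)"
    proof (intro nn_integral_mono)
      fix t assume "t \<in> space \<mu>"
      then have t: "0 < t" "t < 1" by (auto simp: space_mu)
      note k = kern_nonneg[OF beta t]
      have "ennreal p * (\<Sum>m. ennreal (kern \<beta> t n m * cmod (a m))) =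
          (\<Sum>m. ennreal (kern \<beta> t n m * (p * cmod (a m))))"
        using p k by (simp add: mult_ac flip: ennreal_suminf_cmult ennreal_mult')
      also have "\<dots> \<le> (\<Sum>m. ennreal (\<theta> powr (1 - p)) * ennreal (kern \<beta> t n m * (h t powr (p - 1) * cmod (a m) powr p))
          + ennreal (kern \<beta> t n m * ((p - 1) * \<theta> * inverse (h t))))"
      proof (intro suminf_le)
        fix m
        have "kern \<beta> t n m * (p * cmod (a m)) \<le> kern \<beta> t n m *
          (\<theta> powr (1 - p) * (h t powr (p - 1) * cmod (a m) powr p) + (p - 1) * \<theta> * inverse (h t))"
          using p \<theta> h0[OF t] k by (intro mult_left_mono Young_weighted) auto
        also have "\<dots> = \<theta> powr (1 - p) * (kern \<beta> t n m * (h t powr (p - 1) * cmod (a m) powr p))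
            + kern \<beta> t n m * ((p - 1) * \<theta> * inverse (h t))"
          by (simp add: algebra_simps)
        finally show "ennreal (kern \<beta> t n m * (p * cmod (a m))) \<le>
           ennreal (\<theta> powr (1 - p)) * ennreal (kern \<beta> t n m * (h t powr (p - 1) * cmod (a m) powr p))
          + ennreal (kern \<beta> t n m * ((p - 1) * \<theta> * inverse (h t)))"
          using k p \<theta> h0[OF t] by (simp add: ennreal_leI flip: ennreal_mult' ennreal_plus)
      qed auto
      also have "\<dots> = ennreal (\<theta> powr (1 - p)) * (\<Sum>m. ennreal (kern \<beta> t n m * (h t powr (p - 1) * cmod (a m) powr p)))
          + (\<Sum>m. ennreal (kern \<beta> t n m * ((p - 1) * \<theta> * inverse (h t))))"
        by (simp add: suminf_add[symmetric] ennreal_suminf_cmult)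
      also have "(\<Sum>m. ennreal (kern \<beta> t n m * ((p - 1) * \<theta> * inverse (h t)))) =
          ennreal ((1 - t) powr (- \<beta> - 1) * ((p - 1) * \<theta> * inverse (h t)))"
        using k p \<theta> h0[OF t] by (intro suminf_ennreal_eq sums_mult2 kern_sums t) auto
      also have "(1 - t) powr (- \<beta> - 1) * ((p - 1) * \<theta> * inverse (h t)) = (p - 1) * \<theta> * c t"
        by (simp add: row[OF t, symmetric])
      also have "ennreal \<dots> = ennreal ((p - 1) * \<theta>) * ennreal (c t)"
        using c0 by (simp add: ennreal_mult'')
      finally show "ennreal p * (\<Sum>m. ennreal (kern \<beta> t n m * cmod (a m))) \<le>
          ennreal (\<theta> powr (1 - p)) *
          (\<Sum>m. ennreal (kern \<beta> t n m * (h t powr (p - 1) * cmod (a m) powr p)))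
        + ennreal ((p - 1) * \<theta>) * ennreal (c t)" .
    qed
    also have "\<dots> = ennreal (\<theta> powr (1 - p)) * J n + ennreal ((p - 1) * \<theta>) * ?C"
      unfolding J_def C_eq by (simp add: nn_integral_add nn_integral_cmult)
    finally show ?thesis .
  qed

  \<comment> \<open>Exchanging the sums leaves the column sums
    \<open>w m * t powr (- \<beta> - 1)\<close>, and with \<open>h t powr (p - 1)\<close> these
    produce \<open>c t\<close> once more.\<close>
  have sumJ: "(\<Sum>n. ennreal (w n) * J n) = ?C * ennreal A"
  proof -
    have "(\<Sum>n. ennreal (w n) * J n) = (\<integral>\<^sup>+ t. (\<Sum>n. ennreal (w n) *
        (\<Sum>m. ennreal (kern \<beta> t n m * (h t powr (p - 1) * cmod (a m) powr p)))) \<partial>\<mu>)"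
      unfolding J_def by (simp add: nn_integral_suminf nn_integral_cmult)
    also have "\<dots> = (\<integral>\<^sup>+ t. ennreal (c t) * ennreal A \<partial>\<mu>)"
    proof (intro nn_integral_cong)
      fix t assume "t \<in> space \<mu>"
      then have t: "0 < t" "t < 1" by (auto simp: space_mu)
      note k = kern_nonneg[OF beta t]
      have "(\<Sum>n. ennreal (w n) * (\<Sum>m. ennreal (kern \<beta> t n m * (h t powr (p - 1) * cmod (a m) powr p))))
         = (\<Sum>n. \<Sum>m. ennreal (w n * kern \<beta> t n m * (h t powr (p - 1) * cmod (a m) powr p)))"
        using w by (simp add: mult.assoc flip: ennreal_suminf_cmult ennreal_mult')
      also have "\<dots> = (\<Sum>m. \<Sum>n. ennreal (w n * kern \<beta> t n m * (h t powr (p - 1) * cmod (a m) powr p)))"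
        by (rule ennreal_suminf_swap)
      also have "\<dots> = (\<Sum>m. ennreal (w m * t powr (- \<beta> - 1) * (h t powr (p - 1) * cmod (a m) powr p)))"
        using w k by (intro suminf_cong suminf_ennreal_eq sums_mult2 rising_kern_sums beta t) auto
      also have "\<dots> = (\<Sum>m. ennreal (c t * (w m * cmod (a m) powr p)))"
        unfolding col[OF t, symmetric] by (simp only: mult_ac)
      also have "\<dots> = (\<Sum>m. ennreal (c t) * ennreal (w m * cmod (a m) powr p))"
        using c0 by (simp add: ennreal_mult')
      also have "\<dots> = ennreal (c t) * ennreal A"
        using suma w by (simp add: ennreal_suminf_cmult A_def suminf_ennreal2)
      finally show "(\<Sum>n. ennreal (w n) * (\<Sum>m. ennreal (kern \<beta> t n m * (h t powr (p - 1) * cmod (a m) powr p))))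
         = ennreal (c t) * ennreal A" .
    qed
    also have "\<dots> = ?C * ennreal A"
      unfolding C_eq by (intro nn_integral_multc) measurable
    finally show ?thesis .
  qed

  have sumJ_le: "(\<Sum>n. ennreal (w n) * J n) \<le> ennreal (D * A)"
    unfolding sumJ using D A0 by (simp add: ennreal_mult mult_right_mono)
  have J_fin: "J n < top" for n
  proof -
    have "ennreal (w n) * J n \<le> (\<Sum>n. ennreal (w n) * J n)"
      using sum_le_suminf[of "\<lambda>n. ennreal (w n) * J n" "{n}"] by simp
    also have "\<dots> < top"
      using sumJ_le by (rule order_le_less_trans) simp
    finally show ?thesis
      using w(1)[of n] by (auto simp: ennreal_mult_less_top)
  qed
  define Jr where "Jr n = enn2real (J n)" for n
  have J: "J n = ennreal (Jr n)" and Jr0: "0 \<le> Jr n" for n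
    using J_fin by (auto simp: Jr_def)
  \<comment> \<open>The value \<open>\<theta> = 1\<close> suffices for finiteness, after which the
    optimal \<open>\<theta>\<close> can be chosen as a real number.\<close>
  have I_fin: "I n < top" for n
  proof -
    have "I n \<le> ennreal p * I n"
      using p mult_right_mono[of 1 "ennreal p" "I n"] by simp
    also have "\<dots> \<le> ennreal (1 powr (1 - p)) * J n + ennreal ((p - 1) * 1) * ?C"
      by (rule young) simp
    also have "\<dots> < top"
      using J_fin D(2) by (auto simp: ennreal_mult_less_top intro: order_le_less_trans)
    finally show ?thesis .
  qed
  define Ir where "Ir n = enn2real (I n)" for n
  have I: "I n = ennreal (Ir n)" and Ir0: "0 \<le> Ir n" for n
    using I_fin by (auto simp: Ir_def)
  note op = hilbert_op_bound[OF eq_refl[OF I[unfolded I_def]] Ir0]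

  have holder: "Ir n powr p \<le> D powr (p - 1) * Jr n" for n
  proof (cases "Ir n = 0")
    case False
    with Ir0[of n] have pos: "0 < Ir n" by simp
    \<comment> \<open>the choice with equality in the Hoelder inequality\<close>
    define \<theta> where "\<theta> = Ir n / D"
    have \<theta>: "0 < \<theta>" using pos D by (simp add: \<theta>_def)
    have "ennreal (p * Ir n) \<le> ennreal (\<theta> powr (1 - p)) * J n + ennreal ((p - 1) * \<theta>) * ?C"
      using young[OF \<theta>, of n] p Ir0 by (simp add: I ennreal_mult)
    also have "\<dots> \<le> ennreal (\<theta> powr (1 - p)) * ennreal (Jr n) + ennreal ((p - 1) * \<theta>) * ennreal D"
      unfolding J by (intro add_left_mono mult_left_mono D) auto
    also have "\<dots> = ennreal (\<theta> powr (1 - p) * Jr n + (p - 1) * \<theta> * D)"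
      using p \<theta> D Jr0 by (simp add: ennreal_mult ennreal_plus)
    finally have "p * Ir n \<le> \<theta> powr (1 - p) * Jr n + (p - 1) * \<theta> * D"
      using p \<theta> D Jr0 by (subst (asm) ennreal_le_iff) auto
    \<comment> \<open>By the choice of \<open>\<theta>\<close> this term absorbs
      \<open>p - 1\<close> of the \<open>p\<close> copies of \<open>Ir n\<close> on the
      left.\<close>
    also have "(p - 1) * \<theta> * D = (p - 1) * Ir n"
      using D by (simp add: \<theta>_def)
    finally have "Ir n \<le> \<theta> powr (1 - p) * Jr n"
      by (simp add: algebra_simps)
    then have "\<theta> powr (p - 1) * Ir n \<le> \<theta> powr (p - 1) * (\<theta> powr (1 - p) * Jr n)"
      by (intro mult_left_mono) auto
    also have "\<dots> = Jr n"
      using \<theta> by (simp flip: powr_add mult.assoc)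
    finally have "D powr (p - 1) * (\<theta> powr (p - 1) * Ir n) \<le> D powr (p - 1) * Jr n"
      by (intro mult_left_mono) auto
    also have "D powr (p - 1) * (\<theta> powr (p - 1) * Ir n) = Ir n powr p"
      using pos D by (simp add: \<theta>_def powr_divide powr_diff)
    finally show ?thesis .
  qed (use Jr0 in simp)

  have sJ: "summable (\<lambda>n. w n * Jr n)" and sJ_le: "(\<Sum>n. w n * Jr n) \<le> D * A"
  proof -
    have le: "(\<Sum>n. ennreal (w n * Jr n)) \<le> ennreal (D * A)"
      using sumJ_le w Jr0 by (simp add: J ennreal_mult)
    have nn: "0 \<le> w n * Jr n" for n
      using w Jr0 by simp
    show s: "summable (\<lambda>n. w n * Jr n)"
      using le by (intro summable_suminf_not_top nn) (auto simp: top_unique)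
    show "(\<Sum>n. w n * Jr n) \<le> D * A"
      using le D A0 by (simp add: suminf_ennreal2[OF nn s])
  qed
  have le: "w n * cmod (hilbert_op \<mu> \<beta> a n) powr p \<le> D powr (p - 1) * (w n * Jr n)" for n
  proof -
    have "cmod (hilbert_op \<mu> \<beta> a n) powr p \<le> Ir n powr p"
      using op(2) p by (intro powr_mono2) auto
    also note holder
    finally show ?thesis
      unfolding mult.left_commute[of "D powr (p - 1)"] using w(2) by (rule mult_left_mono)
  qed
  have sH: "summable (\<lambda>n. w n * cmod (hilbert_op \<mu> \<beta> a n) powr p)"
    by (rule summable_comparison_test'[OF summable_mult[OF sJ, of "D powr (p - 1)"], of 0])
      (use le w in auto)
  have "(\<Sum>n. w n * cmod (hilbert_op \<mu> \<beta> a n) powr p) \<le> (\<Sum>n. D powr (p - 1) * (w n * Jr n))"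
    using le sH summable_mult[OF sJ] by (intro suminf_le) auto
  also have "\<dots> \<le> D powr (p - 1) * (D * A)"
    using sJ sJ_le by (simp add: suminf_mult mult_left_mono)
  also have "\<dots> = D powr p * A"
    using D by (simp add: powr_diff)
  finally have "(\<Sum>n. w n * cmod (hilbert_op \<mu> \<beta> a n) powr p) powr (1 / p) \<le> (D powr p * A) powr (1 / p)"
    using sH w p by (intro powr_mono2 suminf_nonneg) auto
  also have "\<dots> = D * A powr (1 / p)"
    using D A0 p by (simp add: powr_mult powr_powr)
  finally have "lp_norm p w (hilbert_op \<mu> \<beta> a) \<le> D * lp_norm p w a"
    by (simp add: lp_norm_def A_def)
  then show "(\<forall>n. summable (hilbert_term \<mu> \<beta> a n)) \<and> hilbert_op \<mu> \<beta> a \<in> lp_space p w \<and>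
      lp_norm p w (hilbert_op \<mu> \<beta> a) \<le> D * lp_norm p w a"
    using op(1) sH by (simp add: lp_space_def)
qed

text \<open>The slack in the weak bound tends to zero. Summability and membership do not involve the
  constant and are taken from slack one.\<close>

lemma hilbert_bound_lp:
  assumes "1 \<le> p" "C_fin \<mu> \<beta> p < \<infinity>"
  shows "hilbert_bound \<mu> \<beta> (lp_space p w) (lp_norm p w) (enn2real (C_fin \<mu> \<beta> p))"
proof -
  let ?C = "enn2real (C_fin \<mu> \<beta> p)"
  have C: "C_fin \<mu> \<beta> p = ennreal ?C"
    using assms by simp
  have *: "hilbert_bound \<mu> \<beta> (lp_space p w) (lp_norm p w) (?C + e)" if "0 < e" for e
  proof (rule hilbert_bound_lp_weak[OF assms(1)])
    show "0 < ?C + e"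
      using that by (simp add: add_nonneg_pos)
    show "C_fin \<mu> \<beta> p \<le> ennreal (?C + e)"
      by (subst C) (use that in \<open>simp add: ennreal_leI\<close>)
  qed
  have "lp_norm p w (hilbert_op \<mu> \<beta> a) \<le> ?C * lp_norm p w a" if a: "a \<in> lp_space p w" for a
  proof (rule tendsto_lowerbound)
    show "((\<lambda>e. (?C + e) * lp_norm p w a) \<longlongrightarrow> ?C * lp_norm p w a) (at_right 0)"
      by (auto intro!: tendsto_eq_intros)
    show "\<forall>\<^sub>F e in at_right 0. lp_norm p w (hilbert_op \<mu> \<beta> a) \<le> (?C + e) * lp_norm p w a"
      using eventually_at_right_less[of 0]
    proof eventually_elim
      case (elim e)
      from *[OF this] a show ?case
        by (simp add: hilbert_bound_def)
    qed
  qed simp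
  with *[of 1] show ?thesis
    by (simp add: hilbert_bound_def)
qed

end

subsection \<open>The lower bound on weighted sequence spaces\<close>

text \<open>Fatou's lemma as lower semicontinuity of the integral. It requires no dominating
  function and covers an infinite limit integral.\<close>

lemma nn_integral_eventually_greater:
  fixes f :: "nat \<Rightarrow> 'a \<Rightarrow> real"
  assumes "\<And>i. f i \<in> borel_measurable M"
    and "\<And>x. x \<in> space M \<Longrightarrow> (\<lambda>i. f i x) \<longlonglongrightarrow> g x"
    and "c < (\<integral>\<^sup>+ x. ennreal (g x) \<partial>M)"
  shows "\<forall>\<^sub>F i in sequentially. c < (\<integral>\<^sup>+ x. ennreal (f i x) \<partial>M)"
proof (rule less_LiminfD)
  note assms(3)
  also have "(\<integral>\<^sup>+ x. ennreal (g x) \<partial>M) = (\<integral>\<^sup>+ x. liminf (\<lambda>i. ennreal (f i x)) \<partial>M)"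
    using assms(2)
    by (intro nn_integral_cong lim_imp_Liminf[symmetric] tendsto_ennrealI) auto
  also have "\<dots> \<le> liminf (\<lambda>i. \<integral>\<^sup>+ x. ennreal (f i x) \<partial>M)"
    using assms(1) by (intro nn_integral_liminf) auto
  finally show "c < liminf (\<lambda>i. \<integral>\<^sup>+ x. ennreal (f i x) \<partial>M)" .
qed

context hilbert_measure
begin

text \<open>The integral of \<open>ratio_integrand s n\<close> is the lower bound that Jensen's inequality gives for the ratio of
  the image and the test sequence at \<open>n\<close>. It increases with \<open>n\<close>, so it suffices to control it at one index.\<close>

definition ratio_integrand :: "real \<Rightarrow> nat \<Rightarrow> real \<Rightarrow> real" where
  "ratio_integrand s n t =
     (1 - t) powr (s - \<beta> - 1) * ((real n * t + \<beta> + 1) / (real n + \<beta> + 1)) powr - s"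

lemma ratio_integrand_measurable [measurable]: "ratio_integrand s n \<in> borel_measurable \<mu>"
  unfolding ratio_integrand_def[abs_def] by measurable

lemma shifted_pos: "0 < real n + \<beta> + 1" "0 < t \<Longrightarrow> 0 < real n * t + \<beta> + 1"
  using beta mult_nonneg_nonneg[of "real n" t] by linarith+

text \<open>The quotient inside decreases in \<open>n\<close>: after cross-multiplication the
  difference is \<open>(\<beta> + 1) * (n' - n) * (1 - t)\<close>. The exponent \<open>- s\<close>
  reverses the order.\<close>

lemma ratio_integrand_mono:
  assumes "0 \<le> s" "n \<le> n'" "0 < t" "t < 1"
  shows "ratio_integrand s n t \<le> ratio_integrand s n' t"
proof -
  have "(\<beta> + 1) * ((real n' - real n) * t) \<le> (\<beta> + 1) * ((real n' - real n) * 1)"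
    using assms beta by (intro mult_left_mono) auto
  then have "(real n' * t + \<beta> + 1) * (real n + \<beta> + 1) \<le> (real n * t + \<beta> + 1) * (real n' + \<beta> + 1)"
    by (simp add: algebra_simps)
  then have "(real n' * t + \<beta> + 1) / (real n' + \<beta> + 1) \<le> (real n * t + \<beta> + 1) / (real n + \<beta> + 1)"
    using shifted_pos(1)[of n] shifted_pos(1)[of n'] by (simp only: divide_le_eq le_divide_eq times_divide_eq_left) simp
  then have "((real n * t + \<beta> + 1) / (real n + \<beta> + 1)) powr - s
      \<le> ((real n' * t + \<beta> + 1) / (real n' + \<beta> + 1)) powr - s"
    using assms shifted_pos by (intro powr_mono2') auto
  then show ?thesis
    unfolding ratio_integrand_def by (intro mult_left_mono) auto
qed

text \<open>Integrating \<open>kern_powr_lower\<close> over \<open>t\<close> and factoring out the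
  value of the test sequence at \<open>n\<close> leaves \<open>ratio_integrand\<close>.\<close>

lemma hilbert_op_powr_lower:
  fixes s
  defines "e \<equiv> \<lambda>m. complex_of_real ((real m + \<beta> + 1) powr - s)"
  assumes "0 \<le> s" "summable (hilbert_term \<mu> \<beta> e n)"
  shows "(\<integral>\<^sup>+ t. ennreal (ratio_integrand s n t) \<partial>\<mu>) * ennreal ((real n + \<beta> + 1) powr - s)
     \<le> ennreal (cmod (hilbert_op \<mu> \<beta> e n))"
proof -
  let ?b = "\<lambda>m. (real m + \<beta> + 1) powr - s"
  have "(\<integral>\<^sup>+ t. ennreal (ratio_integrand s n t) \<partial>\<mu>) * ennreal (?b n)
      = (\<integral>\<^sup>+ t. ennreal (ratio_integrand s n t) * ennreal (?b n) \<partial>\<mu>)"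
    by (intro nn_integral_multc[symmetric]) measurable
  also have "\<dots> \<le> (\<integral>\<^sup>+ t. (\<Sum>m. ennreal (kern \<beta> t n m * ?b m)) \<partial>\<mu>)"
  proof (intro nn_integral_mono)
    fix t assume "t \<in> space \<mu>"
    then have t: "0 < t" "t < 1" by (auto simp: space_mu)
    have "ratio_integrand s n t * ?b n = (1 - t) powr (s - \<beta> - 1) * (real n * t + \<beta> + 1) powr - s"
      unfolding ratio_integrand_def
      using shifted_pos(1)[of n] shifted_pos(2)[of t n] t by (simp add: powr_divide)
    then show "ennreal (ratio_integrand s n t) * ennreal (?b n) \<le> (\<Sum>m. ennreal (kern \<beta> t n m * ?b m))"
      using kern_powr_lower[OF beta t \<open>0 \<le> s\<close>, of n] by (simp flip: ennreal_mult'')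
  qed
  also have "\<dots> = ennreal (cmod (hilbert_op \<mu> \<beta> e n))"
    using assms unfolding e_def by (intro hilbert_op_nonneg_real[symmetric]) auto
  finally show ?thesis .
qed

text \<open>Fatou's lemma is used twice: first \<open>n\<close> tends to infinity at the critical
  exponent \<open>(\<beta> + 1) / p\<close>, which fixes \<open>N\<close>; then the exponent
  decreases to the critical one at this \<open>N\<close>. Monotonicity in \<open>n\<close> extends
  the bound to all larger indices, so \<open>N\<close> does not depend on \<open>k\<close>.\<close>

lemma exists_ratio_greater:
  assumes p: "1 \<le> p" and c: "c < C_fin \<mu> \<beta> p"
  shows "\<exists>N. \<forall>\<^sub>F k in sequentially. \<forall>n\<ge>N.
     c < (\<integral>\<^sup>+ t. ennreal (ratio_integrand ((\<beta> + 1) / p + inverse (real (Suc k))) n t) \<partial>\<mu>)"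
proof -
  define s0 where "s0 = (\<beta> + 1) / p"
  have s0: "0 < s0" using p beta by (simp add: s0_def)
  have "\<forall>\<^sub>F n in sequentially. c < (\<integral>\<^sup>+ t. ennreal (ratio_integrand s0 n t) \<partial>\<mu>)"
  proof (rule nn_integral_eventually_greater)
    show "ratio_integrand s0 i \<in> borel_measurable \<mu>" for i by measurable
  next
    have e: "s0 - \<beta> - 1 = - (1 - 1 / p) * (\<beta> + 1)" "- s0 = - (1 / p) * (\<beta> + 1)"
      using p by (simp_all add: s0_def field_simps)
    show "c < (\<integral>\<^sup>+ t. ennreal ((1 - t) powr (s0 - \<beta> - 1) * t powr - s0) \<partial>\<mu>)"
      using c unfolding C_fin_def e .
  next
    fix t assume "t \<in> space \<mu>"
    then have t: "0 < t" "t < 1" by (auto simp: space_mu)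
    have "(\<lambda>n. (t + (\<beta> + 1) * inverse (real n)) / (1 + (\<beta> + 1) * inverse (real n)))
        \<longlonglongrightarrow> (t + (\<beta> + 1) * 0) / (1 + (\<beta> + 1) * 0)"
      by (intro tendsto_intros lim_inverse_n) auto
    then have "(\<lambda>n. (t + (\<beta> + 1) * inverse (real n)) / (1 + (\<beta> + 1) * inverse (real n))) \<longlonglongrightarrow> t"
      by simp
    then have "(\<lambda>n. (real n * t + \<beta> + 1) / (real n + \<beta> + 1)) \<longlonglongrightarrow> t"
    proof (rule Lim_transform_eventually)
      show "\<forall>\<^sub>F n in sequentially. (t + (\<beta> + 1) * inverse (real n)) / (1 + (\<beta> + 1) * inverse (real n))
          = (real n * t + \<beta> + 1) / (real n + \<beta> + 1)"
        using eventually_gt_at_top[of "0::nat"]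
      proof eventually_elim
        case (elim n)
        have "(t + (\<beta> + 1) * inverse (real n)) / (1 + (\<beta> + 1) * inverse (real n)) =
          (real n * (t + (\<beta> + 1) * inverse (real n))) / (real n * (1 + (\<beta> + 1) * inverse (real n)))"
          using elim by simp
        also have "\<dots> = (real n * t + \<beta> + 1) / (real n + \<beta> + 1)"
          using elim by (simp add: distrib_left add.assoc mult.left_commute[of "real n"])
        finally show ?case .
      qed
    qed
    then show "(\<lambda>n. ratio_integrand s0 n t) \<longlonglongrightarrow> (1 - t) powr (s0 - \<beta> - 1) * t powr - s0"
      unfolding ratio_integrand_def using t by (intro tendsto_intros) auto
  qed
  from eventually_happens'[OF sequentially_bot this]
  obtain N where N: "c < (\<integral>\<^sup>+ t. ennreal (ratio_integrand s0 N t) \<partial>\<mu>)"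
    by (rule exE)
  have "\<forall>\<^sub>F k in sequentially.
      c < (\<integral>\<^sup>+ t. ennreal (ratio_integrand (s0 + inverse (real (Suc k))) N t) \<partial>\<mu>)"
  proof (rule nn_integral_eventually_greater[OF _ _ N])
    show "ratio_integrand (s0 + inverse (real (Suc k))) N \<in> borel_measurable \<mu>" for k by measurable
  next
    fix t assume "t \<in> space \<mu>"
    then have t: "0 < t" "t < 1" by (auto simp: space_mu)
    have lim: "(\<lambda>k. s0 + inverse (real (Suc k))) \<longlonglongrightarrow> s0"
      using tendsto_add[OF tendsto_const LIMSEQ_inverse_real_of_nat, of s0] by simp
    show "(\<lambda>k. ratio_integrand (s0 + inverse (real (Suc k))) N t) \<longlonglongrightarrow> ratio_integrand s0 N t"
      unfolding ratio_integrand_def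
      using t shifted_pos(1)[of N] shifted_pos(2)[of t N] by (intro tendsto_intros lim) auto
  qed
  then have "\<forall>\<^sub>F k in sequentially. \<forall>n\<ge>N.
     c < (\<integral>\<^sup>+ t. ennreal (ratio_integrand (s0 + inverse (real (Suc k))) n t) \<partial>\<mu>)"
  proof eventually_elim
    case (elim k)
    show ?case
    proof (intro allI impI)
      fix n assume n: "N \<le> n"
      note elim
      also have "(\<integral>\<^sup>+ t. ennreal (ratio_integrand (s0 + inverse (real (Suc k))) N t) \<partial>\<mu>)
          \<le> (\<integral>\<^sup>+ t. ennreal (ratio_integrand (s0 + inverse (real (Suc k))) n t) \<partial>\<mu>)"
        using s0 n by (intro nn_integral_mono ennreal_leI ratio_integrand_mono) (auto simp: space_mu)
      finally show "c < (\<integral>\<^sup>+ t. ennreal (ratio_integrand (s0 + inverse (real (Suc k))) n t) \<partial>\<mu>)" .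
    qed
  qed
  then show ?thesis
    unfolding s0_def by (rule exI)
qed

text \<open>Above the critical exponent the power sequence lies in the space and
  \<open>suminf v\<close> is the \<open>p\<close>-th power of its norm. Since
  \<open>suminf v\<close> is strictly positive, the norm inequality forces \<open>0 \<le> D\<close>
  and can be raised to the power \<open>p\<close>.\<close>

lemma powr_test_sequence:
  assumes p: "1 \<le> p" and D: "hilbert_bound \<mu> \<beta> (lp_space p w) (lp_norm p w) D" and s: "s > (\<beta> + 1) / p"
  defines "e \<equiv> \<lambda>m. complex_of_real ((real m + \<beta> + 1) powr - s)"
    and "v \<equiv> \<lambda>n. w n * (real n + \<beta> + 1) powr - (s * p)"
  shows "0 \<le> D" "summable v" "summable (hilbert_term \<mu> \<beta> e n)"
    and "summable (\<lambda>n. w n * cmod (hilbert_op \<mu> \<beta> e n) powr p)"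
    and "(\<Sum>n. w n * cmod (hilbert_op \<mu> \<beta> e n) powr p) \<le> D powr p * suminf v"
proof -
  have w: "0 < w n" "0 \<le> w n" for n
    using rising_pos[OF beta] rising_nonneg[OF beta] by auto
  have v: "w n * cmod (e n) powr p = v n" for n
    by (simp add: e_def v_def powr_powr)
  have sp: "s * p > \<beta> + 1"
    using s p by (simp add: field_simps)
  then show sv: "summable v"
    unfolding v_def by (subst summable_rising_powr_iff[OF beta])
  have vpos: "0 < v n" for n
    using w(1)[of n] shifted_pos(1)[of n] by (simp add: v_def)
  have e: "e \<in> lp_space p w" and N: "lp_norm p w e = suminf v powr (1 / p)"
    using sv by (simp_all add: lp_space_def lp_norm_def v)
  from D e have *: "(\<forall>n. summable (hilbert_term \<mu> \<beta> e n)) \<and> hilbert_op \<mu> \<beta> e \<in> lp_space p w \<and>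
      lp_norm p w (hilbert_op \<mu> \<beta> e) \<le> D * lp_norm p w e"
    unfolding hilbert_bound_def by (rule bspec)
  then show "summable (hilbert_term \<mu> \<beta> e n)"
    by simp
  from * show sH: "summable (\<lambda>n. w n * cmod (hilbert_op \<mu> \<beta> e n) powr p)"
    by (simp add: lp_space_def)
  let ?S = "\<Sum>n. w n * cmod (hilbert_op \<mu> \<beta> e n) powr p"
  have S0: "0 \<le> ?S"
    using sH w by (intro suminf_nonneg) auto
  have le: "?S powr (1 / p) \<le> D * suminf v powr (1 / p)"
    using * N by (simp add: lp_norm_def)
  have V: "0 < suminf v"
    using sv vpos by (intro suminf_pos) auto
  have "0 \<le> D * suminf v powr (1 / p)"
    using le by (rule order_trans[rotated]) simp
  then show D0: "0 \<le> D"
    using V by (simp add: zero_le_mult_iff)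
  have "?S = (?S powr (1 / p)) powr p"
    using S0 p by (simp add: powr_powr)
  also have "\<dots> \<le> (D * suminf v powr (1 / p)) powr p"
    using p le by (intro powr_mono2) auto
  also have "\<dots> = D powr p * suminf v"
    using D0 V p by (simp add: powr_mult powr_powr)
  finally show "?S \<le> D powr p * suminf v" .
qed

text \<open>If \<open>D < E < C_fin\<close>, then from a fixed index \<open>N\<close> on the image
  is at least \<open>E\<close> times the test sequence, so the tail of the series \<open>v\<close>
  is controlled by its first \<open>N\<close> terms uniformly near the critical exponent. In the
  limit the divergent critical series would converge.\<close>

lemma hilbert_bound_lpD:
  assumes p: "1 \<le> p" and D: "hilbert_bound \<mu> \<beta> (lp_space p w) (lp_norm p w) D"
  shows "0 \<le> D" "C_fin \<mu> \<beta> p \<le> ennreal D"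
proof -
  define s0 where "s0 = (\<beta> + 1) / p"
  have s0: "0 < s0" using p beta by (simp add: s0_def)
  show D0: "0 \<le> D"
    using powr_test_sequence(1)[OF p D, of "s0 + 1"] by (simp add: s0_def)
  show "C_fin \<mu> \<beta> p \<le> ennreal D"
  proof (rule ccontr)
    assume "\<not> C_fin \<mu> \<beta> p \<le> ennreal D"
    then obtain c where c: "ennreal D < c" "c < C_fin \<mu> \<beta> p"
      using dense[of "ennreal D" "C_fin \<mu> \<beta> p"] by (auto simp: not_le)
    then obtain E where E: "c = ennreal E" "0 \<le> E"
      by (cases c rule: ennreal_cases) auto
    with c D0 have DE: "D < E" by (simp add: ennreal_less_iff)
    have w: "0 < w n" "0 \<le> w n" for n
      using rising_pos[OF beta] rising_nonneg[OF beta] by auto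
    define v where "v s n = w n * (real n + \<beta> + 1) powr - (s * p)" for s n
    have v0: "0 \<le> v s n" for s n
      by (simp add: v_def w)
    let ?s = "\<lambda>k. s0 + inverse (real (Suc k))"
    obtain N where N: "\<forall>\<^sub>F k in sequentially. \<forall>n\<ge>N.
       ennreal E < (\<integral>\<^sup>+ t. ennreal (ratio_integrand (?s k) n t) \<partial>\<mu>)"
      using exists_ratio_greater[OF p c(2)] unfolding E s0_def by blast
    \<comment> \<open>Only \<open>M\<close> terms of the tail are kept, so that the exponent can
      tend to \<open>s0\<close> in a finite sum for each fixed \<open>M\<close>.\<close>
    have bound: "\<forall>\<^sub>F k in sequentially.
       (E powr p - D powr p) * (\<Sum>n<M. v (?s k) (n + N)) \<le> D powr p * (\<Sum>n<N. v (?s k) n)" for M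
      using N
    proof eventually_elim
      case (elim k)
      define s where "s = ?s k"
      have s: "s > (\<beta> + 1) / p" "0 \<le> s"
        using s0 by (simp_all add: s_def flip: s0_def)
      define e where "e m = complex_of_real ((real m + \<beta> + 1) powr - s)" for m
      note ts = powr_test_sequence[OF p D s(1), folded e_def v_def]
      let ?H = "\<lambda>n. w n * cmod (hilbert_op \<mu> \<beta> e n) powr p"
      have H: "E powr p * v s n \<le> ?H n" if n: "N \<le> n" for n
      proof -
        have "ennreal (E * (real n + \<beta> + 1) powr - s) = ennreal E * ennreal ((real n + \<beta> + 1) powr - s)"
          using E by (simp add: ennreal_mult)
        also have "\<dots> \<le> (\<integral>\<^sup>+ t. ennreal (ratio_integrand s n t) \<partial>\<mu>) * ennreal ((real n + \<beta> + 1) powr - s)"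
          using elim n by (intro mult_right_mono) (auto simp: s_def intro: less_imp_le)
        also have "\<dots> \<le> ennreal (cmod (hilbert_op \<mu> \<beta> e n))"
          using s ts(3) unfolding e_def by (intro hilbert_op_powr_lower)
        finally have "E * (real n + \<beta> + 1) powr - s \<le> cmod (hilbert_op \<mu> \<beta> e n)"
          by simp
        then have "(E * (real n + \<beta> + 1) powr - s) powr p \<le> cmod (hilbert_op \<mu> \<beta> e n) powr p"
          using E p by (intro powr_mono2) auto
        then have "w n * (E * (real n + \<beta> + 1) powr - s) powr p \<le> ?H n"
          using w by (intro mult_left_mono)
        then show ?thesis
          using E by (simp add: v_def powr_mult powr_powr mult_ac)
      qed
      have sv: "summable (v s)"
        using ts(2) by (simp add: v_def[abs_def])
      have svN: "summable (\<lambda>n. v s (n + N))"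
        using sv by (simp add: summable_iff_shift)
      have "E powr p * (\<Sum>n. v s (n + N)) = (\<Sum>n. E powr p * v s (n + N))"
        using svN by (rule suminf_mult[symmetric])
      also have "\<dots> \<le> (\<Sum>n. ?H (n + N))"
        using H summable_mult[OF svN] ts(4)
        by (intro suminf_le summable_ignore_initial_segment[of ?H]) auto
      also have "\<dots> \<le> (\<Sum>n. ?H n)"
        using suminf_split_initial_segment[OF ts(4), of N] w by (simp add: sum_nonneg)
      also have "\<dots> \<le> D powr p * suminf (v s)"
        using ts(5) by (simp add: v_def[abs_def])
      also have "suminf (v s) = (\<Sum>n. v s (n + N)) + (\<Sum>n<N. v s n)"
        by (rule suminf_split_initial_segment[OF sv])
      finally have "(E powr p - D powr p) * (\<Sum>n. v s (n + N)) \<le> D powr p * (\<Sum>n<N. v s n)"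
        by (simp add: algebra_simps)
      moreover have "(E powr p - D powr p) * (\<Sum>n<M. v s (n + N)) \<le> (E powr p - D powr p) * (\<Sum>n. v s (n + N))"
        using svN v0 DE D0 p by (intro mult_left_mono sum_le_suminf) (auto intro!: powr_mono2)
      ultimately show ?case
        unfolding s_def by linarith
    qed
    have ED: "0 < E powr p - D powr p"
      using DE D0 p by (simp add: powr_less_mono2)
    have lim: "(\<lambda>k. v (?s k) n) \<longlonglongrightarrow> v s0 n" for n
    proof -
      have "(\<lambda>k. s0 + inverse (real (Suc k))) \<longlonglongrightarrow> s0"
        using tendsto_add[OF tendsto_const LIMSEQ_inverse_real_of_nat, of s0] by simp
      then show ?thesis
        unfolding v_def using shifted_pos(1)[of n] by (intro tendsto_intros) auto
    qed
    have "(E powr p - D powr p) * (\<Sum>n<M. v s0 (n + N)) \<le> D powr p * (\<Sum>n<N. v s0 n)" for M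
      by (rule tendsto_le[OF _ _ _ bound[of M]]) (simp, (intro tendsto_intros lim)+)
    then have "(\<Sum>n<M. v s0 (n + N)) \<le> D powr p * (\<Sum>n<N. v s0 n) / (E powr p - D powr p)" for M
      using ED by (simp add: field_simps)
    then have "summable (\<lambda>n. v s0 (n + N))"
      using v0 by (intro summableI_nonneg_bounded)
    then have "summable (v s0)"
      by (simp add: summable_iff_shift)
    \<comment> \<open>Here \<open>s0 * p\<close> equals \<open>\<beta> + 1\<close>, the threshold at
      which the series diverges.\<close>
    then have "s0 * p > \<beta> + 1"
      unfolding v_def[abs_def] by (subst (asm) summable_rising_powr_iff[OF beta])
    then show False
      using p by (simp add: s0_def)
  qed
qed

end

theorem corollary1p5:
  fixes \<mu> :: "real measure" and \<beta> :: real
  assumes "finite_measure \<mu>"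
    and "sets \<mu> = sets (restrict_space borel {0<..<1})"
    and "\<beta> > -1"
  shows "(\<forall>p w. 1 \<le> p \<longrightarrow> w = (\<lambda>m. rising m \<beta>) \<longrightarrow>
            (hilbert_bounded_on \<mu> \<beta> (lp_space p w) (lp_norm p w) \<longleftrightarrow> C_fin \<mu> \<beta> p < \<infinity>) \<and>
            (hilbert_bounded_on \<mu> \<beta> (lp_space p w) (lp_norm p w) \<longrightarrow>
               hilbert_norm_on \<mu> \<beta> (lp_space p w) (lp_norm p w) = enn2real (C_fin \<mu> \<beta> p))) \<and>
         (hilbert_bounded_on \<mu> \<beta> linf_space linf_norm \<longleftrightarrow> C_inf \<mu> \<beta> < \<infinity>) \<and>
         (hilbert_bounded_on \<mu> \<beta> linf_space linf_norm \<longrightarrow>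
            hilbert_norm_on \<mu> \<beta> linf_space linf_norm = enn2real (C_inf \<mu> \<beta>))"
proof -
  interpret finite_measure \<mu> by fact
  interpret hilbert_measure \<mu> \<beta> by unfold_locales fact+
  show ?thesis
  proof (intro conjI allI)
    fix p :: real and w' :: "nat \<Rightarrow> real"
    show "1 \<le> p \<longrightarrow> w' = (\<lambda>m. rising m \<beta>) \<longrightarrow>
            (hilbert_bounded_on \<mu> \<beta> (lp_space p w') (lp_norm p w') \<longleftrightarrow> C_fin \<mu> \<beta> p < \<infinity>) \<and>
            (hilbert_bounded_on \<mu> \<beta> (lp_space p w') (lp_norm p w') \<longrightarrow>
               hilbert_norm_on \<mu> \<beta> (lp_space p w') (lp_norm p w') = enn2real (C_fin \<mu> \<beta> p))"
    proof (intro impI, hypsubst)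
      assume p: "1 \<le> p"
      show "(hilbert_bounded_on \<mu> \<beta> (lp_space p w) (lp_norm p w) \<longleftrightarrow> C_fin \<mu> \<beta> p < \<infinity>) \<and>
            (hilbert_bounded_on \<mu> \<beta> (lp_space p w) (lp_norm p w) \<longrightarrow>
               hilbert_norm_on \<mu> \<beta> (lp_space p w) (lp_norm p w) = enn2real (C_fin \<mu> \<beta> p))"
        by (intro conjI; rule hilbert_norm_eqI)
          (fact hilbert_bound_lp[OF p] hilbert_bound_lpD[OF p])+
    qed
  next
    show "hilbert_bounded_on \<mu> \<beta> linf_space linf_norm \<longleftrightarrow> C_inf \<mu> \<beta> < \<infinity>"
      and "hilbert_bounded_on \<mu> \<beta> linf_space linf_norm \<longrightarrow>
            hilbert_norm_on \<mu> \<beta> linf_space linf_norm = enn2real (C_inf \<mu> \<beta>)"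
      by (rule hilbert_norm_eqI, rule hilbert_bound_linf, assumption,
          erule hilbert_bound_linfD, erule hilbert_bound_linfD)+
  qed
qed

end
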